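(* There is an absolute constant $c>0$ such that for each integer $N\ge 1$ there is a choice of coefficients $a_{n,m}\in\mathbb{C}$, $-N\le n,m\le N$, not all zero, such that $$\Big\|\sum_{n,m=-N}^N a_{n,m}\,e\big(nx+my-(n^2+m^2)x^3\big)\Big\|_{L^2([-1,1]^2)}\ge c\, N^{\frac1{12}}\Big(\sum_{n,m=-N}^N|a_{n,m}|^2\Big)^{1/2}.$$
   Context: $e(z)=e^{2\pi i z}$. The $L^2([-1,1]^2)$ norm is taken in the real variables $(x,y)$. *)

theory Defs
  imports "HOL-Analysis.Analysis"
begin

definition ee :: "complex \<Rightarrow> complex" where
  "ee z = exp (2 * of_real pi * \<i> * z)"

(* The Bochner integral is 0 for non-integrable functions, so this is the L^2 norm
   only for f that is square-integrable on S (e.g. continuous f and compact S). *)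
definition L2_norm_on :: "'a::euclidean_space set \<Rightarrow> ('a \<Rightarrow> complex) \<Rightarrow> real" where
  "L2_norm_on S f = sqrt (LINT p:S|lborel. (cmod (f p))\<^sup>2)"

end

(* The phase n x - n^2 x^3 has mixed derivative 1 - 6 n x^2, which vanishes at n = N,
   x = r = (6 N)^(-1/2). Expanding around this point, for n = N - k and x = r + t the phase is a
   function of n plus a function of t plus an error of order k^2 t / N + N^(1/2) k t^2. The error
   stays small for 0 <= k <= N^(5/6) / 4 and 0 <= t <= N^(-2/3) / 4. Unimodular coefficients
   supported on m = 0 and these n, chosen to cancel the part of the phase depending on n only,
   therefore produce a sum of size comparable to N^(5/6) on a rectangle of measure comparable to
   N^(-2/3), so the ratio of the squared norms is at least of order
   N^(5/6) N^(-2/3) = N^(1/6). *)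
theory Submission
  imports Defs
begin

lemma ee_of_real: "ee (of_real x) = cis (2 * pi * x)"
  by (simp add: ee_def cis_conv_exp mult_ac)

text \<open>After rotation by \<open>cis (- g)\<close> every term lies within angle pi/3 of the
  positive real axis, so its real part is at least cos (pi/3) = 1/2 and nothing cancels.\<close>

lemma cmod_sum_cis_ge:
  assumes "finite A" and close: "\<And>n. n \<in> A \<Longrightarrow> \<bar>\<theta> n - g\<bar> \<le> pi / 3"
  shows "real (card A) / 2 \<le> cmod (\<Sum>n\<in>A. cis (\<theta> n))"
proof -
  have "1 / 2 \<le> cos (\<theta> n - g)" if "n \<in> A" for n
  proof -
    have "cos (pi / 3) \<le> cos \<bar>\<theta> n - g\<bar>"
      using close[OF that] by (intro cos_monotone_0_pi_le) auto
    then show ?thesis by (simp add: cos_60)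
  qed
  then have "(\<Sum>n\<in>A. 1 / 2) \<le> (\<Sum>n\<in>A. cos (\<theta> n - g))"
    by (intro sum_mono)
  also have "\<dots> = Re (\<Sum>n\<in>A. cis (\<theta> n - g))" by simp
  also have "\<dots> \<le> cmod (\<Sum>n\<in>A. cis (\<theta> n - g))" by (rule complex_Re_le_cmod)
  also have "(\<Sum>n\<in>A. cis (\<theta> n - g)) = cis (- g) * (\<Sum>n\<in>A. cis (\<theta> n))"
    by (simp add: sum_distrib_left cis_mult)
  finally show ?thesis by (simp add: norm_mult)
qed

text \<open>Restricting to \<open>R\<close> only loses mass. Compactness and continuity supply the
  integrability that monotonicity needs: a non-integrable square would have the default integral
  0.\<close>

lemma L2_norm_on_ge:
  fixes f :: "'a::euclidean_space \<Rightarrow> complex"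
  assumes S: "compact S" and f: "continuous_on S f"
    and R: "compact R" "R \<subseteq> S"
    and M: "0 \<le> M" "\<And>p. p \<in> R \<Longrightarrow> M \<le> cmod (f p)"
  shows "M * sqrt (measure lborel R) \<le> L2_norm_on S f"
proof -
  have "(LINT p:R|lborel. M\<^sup>2) \<le> (LINT p:S|lborel. (cmod (f p))\<^sup>2)"
    unfolding set_lebesgue_integral_def
  proof (rule integral_mono)
    show "integrable lborel (\<lambda>p. indicator R p *\<^sub>R M\<^sup>2)"
      using R by (intro borel_integrable_compact) auto
    show "integrable lborel (\<lambda>p. indicator S p *\<^sub>R (cmod (f p))\<^sup>2)"
      using S f by (intro borel_integrable_compact continuous_intros)
    show "indicator R p *\<^sub>R M\<^sup>2 \<le> indicator S p *\<^sub>R (cmod (f p))\<^sup>2" for p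
      using R M by (auto simp: indicator_def intro!: power_mono)
  qed
  then have "M\<^sup>2 * measure lborel R \<le> (LINT p:S|lborel. (cmod (f p))\<^sup>2)"
    by (simp add: set_lebesgue_integral_def mult.commute)
  then have "sqrt (M\<^sup>2 * measure lborel R) \<le> L2_norm_on S f"
    unfolding L2_norm_on_def by (rule real_sqrt_le_mono)
  then show ?thesis using M by (simp add: real_sqrt_mult)
qed

text \<open>The three groups depend on \<open>k\<close> only, on \<open>t\<close> only, and on both.
  The hypothesis is the vanishing of the mixed derivative at (N, r); it removes the bilinear term in
  \<open>k\<close> and \<open>t\<close>, so the last group is of higher order.\<close>

lemma phase_expansion:
  fixes N r t k :: real
  assumes "6 * N * r\<^sup>2 = 1"
  shows "(N - k) * (r + t) - (N - k)\<^sup>2 * (r + t) ^ 3 =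
    ((N - k) * r - (N - k)\<^sup>2 * r ^ 3) + (N * t - N\<^sup>2 * ((r + t) ^ 3 - r ^ 3)) +
    (2 * N * k * (3 * r * t\<^sup>2 + t ^ 3) - k\<^sup>2 * (3 * r\<^sup>2 * t + 3 * r * t\<^sup>2 + t ^ 3))"
  (is "?l = ?r")
proof -
  have "?l - ?r = k * t * (6 * N * r\<^sup>2 - 1)"
    by algebra
  then show ?thesis using assms by simp
qed

text \<open>Here \<open>q\<close> stands for N^(1/6), which makes every exponent an integer. The
  ranges of \<open>t\<close> and \<open>k\<close> are such that all powers of \<open>q\<close>
  cancel in the bounds for both error terms.\<close>

lemma phase_error_bound:
  fixes q r t k :: real
  assumes q: "q \<ge> 1" and r: "r > 0" "6 * q ^ 6 * r\<^sup>2 = 1"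
    and t: "0 \<le> t" "t \<le> 1 / (4 * q ^ 4)" and k: "0 \<le> k" "k \<le> q ^ 5 / 4"
  shows "\<bar>2 * q ^ 6 * k * (3 * r * t\<^sup>2 + t ^ 3) - k\<^sup>2 * (3 * r\<^sup>2 * t + 3 * r * t\<^sup>2 + t ^ 3)\<bar> \<le> 1 / 8"
proof -
  have r2: "r\<^sup>2 = 1 / (6 * q ^ 6)" using r q by (simp add: field_simps)
  have "r \<le> 1 / (2 * q ^ 3)"
  proof (rule power2_le_imp_le)
    show "r\<^sup>2 \<le> (1 / (2 * q ^ 3))\<^sup>2"
      using q unfolding r2 by (simp add: power2_eq_square field_simps flip: power_add)
  qed (use q in auto)
  \<comment> \<open>This lets each bracket collapse to a single monomial: at most
    \<open>4 * r * t\<^sup>2\<close> in the first error term and \<open>7 * r\<^sup>2 * t\<close> in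
    the second.\<close>
  have "t \<le> r"
  proof (rule power2_le_imp_le)
    have "t\<^sup>2 \<le> (1 / (4 * q ^ 4))\<^sup>2" using t by (intro power_mono)
    also have "\<dots> = 1 / (16 * q ^ 8)" by (simp add: power_divide power_mult_distrib flip: power_mult)
    also have "\<dots> \<le> 1 / (6 * q ^ 6)"
    proof (rule divide_left_mono)
      have "q ^ 6 \<le> q ^ 8" using q by (intro power_increasing) auto
      then show "6 * q ^ 6 \<le> 16 * q ^ 8" using q zero_le_power[of q 8] by linarith
    qed (use q in auto)
    finally show "t\<^sup>2 \<le> r\<^sup>2" by (simp add: r2)
  qed (use r in auto)
  have t3: "t ^ 3 \<le> r * t\<^sup>2" using mult_right_mono[OF \<open>t \<le> r\<close>, of "t\<^sup>2"]
    by (simp add: power3_eq_cube power2_eq_square mult.assoc)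
  have t2: "r * t\<^sup>2 \<le> r\<^sup>2 * t" using \<open>t \<le> r\<close> t r
    by (simp add: power2_eq_square mult_mono)
  \<comment> \<open>The exponents of \<open>q\<close> add up to 6 + 5 - 3 - 8 = 0 here, and to 10 -
    6 - 4 = 0 in the second error term below.\<close>
  have "2 * q ^ 6 * k * (3 * r * t\<^sup>2 + t ^ 3) \<le> 2 * q ^ 6 * (q ^ 5 / 4) * (4 * (1 / (2 * q ^ 3)) * (1 / (4 * q ^ 4))\<^sup>2)"
  proof (intro mult_mono)
    have "3 * r * t\<^sup>2 + t ^ 3 \<le> 4 * r * t\<^sup>2" using t3 by simp
    also have "\<dots> \<le> 4 * (1 / (2 * q ^ 3)) * (1 / (4 * q ^ 4))\<^sup>2"
      using t r q \<open>r \<le> 1 / (2 * q ^ 3)\<close> by (intro mult_mono power_mono) auto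
    finally show "3 * r * t\<^sup>2 + t ^ 3 \<le> 4 * (1 / (2 * q ^ 3)) * (1 / (4 * q ^ 4))\<^sup>2" .
  qed (use k q r t in auto)
  also have "\<dots> = 1 / 16" using q by (simp add: field_simps flip: power_mult power_add)
  finally have 1: "2 * q ^ 6 * k * (3 * r * t\<^sup>2 + t ^ 3) \<le> 1 / 16" .
  have "k\<^sup>2 * (3 * r\<^sup>2 * t + 3 * r * t\<^sup>2 + t ^ 3) \<le> (q ^ 5 / 4)\<^sup>2 * (7 * r\<^sup>2 * (1 / (4 * q ^ 4)))"
  proof (intro mult_mono power_mono)
    have "3 * r\<^sup>2 * t + 3 * r * t\<^sup>2 + t ^ 3 \<le> 7 * r\<^sup>2 * t" using t2 t3 unfolding mult.assoc by linarith
    also have "\<dots> \<le> 7 * r\<^sup>2 * (1 / (4 * q ^ 4))"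
      using t by (intro mult_left_mono) auto
    finally show "3 * r\<^sup>2 * t + 3 * r * t\<^sup>2 + t ^ 3 \<le> 7 * r\<^sup>2 * (1 / (4 * q ^ 4))" .
  qed (use k q r t in auto)
  also have "\<dots> = 7 / 384" using q unfolding r2 by (simp add: field_simps flip: power_mult power_add)
  finally have 2: "k\<^sup>2 * (3 * r\<^sup>2 * t + 3 * r * t\<^sup>2 + t ^ 3) \<le> 7 / 384" .
  \<comment> \<open>A difference of two nonnegative numbers is at most the larger one in absolute
    value.\<close>
  have "0 \<le> 2 * q ^ 6 * k * (3 * r * t\<^sup>2 + t ^ 3)" "0 \<le> k\<^sup>2 * (3 * r\<^sup>2 * t + 3 * r * t\<^sup>2 + t ^ 3)"
    using k q r t by auto
  with 1 2 show ?thesis by linarith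
qed

theorem theorem4p2:
  shows "\<exists>c::real. c > 0 \<and>
    (\<forall>N::nat. N \<ge> 1 \<longrightarrow>
      (\<exists>a :: int \<Rightarrow> int \<Rightarrow> complex.
        (\<exists>n\<in>{-int N..int N}. \<exists>m\<in>{-int N..int N}. a n m \<noteq> 0) \<and>
        L2_norm_on ({-1..1::real} \<times> {-1..1::real})
          (\<lambda>(x, y). \<Sum>n\<in>{-int N..int N}. \<Sum>m\<in>{-int N..int N}.
             a n m * ee (of_real (of_int n * x + of_int m * y - of_int (n\<^sup>2 + m\<^sup>2) * x ^ 3)))
        \<ge> c * real N powr (1/12) *
            sqrt (\<Sum>n\<in>{-int N..int N}. \<Sum>m\<in>{-int N..int N}. (cmod (a n m))\<^sup>2)))"
proof (intro exI[of _ "1 / 8"] conjI allI impI)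
  fix N :: nat
  assume N: "1 \<le> N"
  define q where "q = real N powr (1 / 6)"
  define r where "r = 1 / sqrt (6 * real N)"
  define T where "T = 1 / (4 * q ^ 4)"
  define A where "A = {\<lceil>real N - q ^ 5 / 4\<rceil>..int N}"
  define a :: "int \<Rightarrow> int \<Rightarrow> complex" where
    "a n m = (if m = 0 then if n \<in> A then cis (- 2 * pi * (n * r - n\<^sup>2 * r ^ 3)) else 0 else 0)"
    for n m
  let ?I = "{-int N..int N}" and ?S = "{-1..1::real} \<times> {-1..1::real}"
  let ?f = "\<lambda>(x, y). \<Sum>n\<in>?I. \<Sum>m\<in>?I.
    a n m * ee (of_real (of_int n * x + of_int m * y - of_int (n\<^sup>2 + m\<^sup>2) * x ^ 3))"
  have q: "q \<ge> 1" "q ^ 6 = real N"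
    using N by (auto simp: q_def ge_one_powr_ge_zero powr_powr simp flip: powr_realpow)
  have r: "r > 0" "6 * q ^ 6 * r\<^sup>2 = 1"
    using N q by (auto simp: r_def power_divide)
  have T: "0 < T" "T \<le> 1 / 4"
    using q by (auto simp: T_def field_simps)
  have "r \<le> 1 / 2"
  proof -
    have "sqrt (2\<^sup>2) \<le> sqrt (6 * real N)" using N by (intro real_sqrt_le_mono) auto
    then have "1 / sqrt (6 * real N) \<le> 1 / 2" using N by (intro divide_left_mono) auto
    then show ?thesis by (simp add: r_def)
  qed
  \<comment> \<open>Hence q^5 / 4 is at most N, and the left end of \<open>A\<close> is
    nonnegative.\<close>
  have "q ^ 5 \<le> q ^ 6" using q by (intro power_increasing) auto
  then have "A \<subseteq> ?I" using q(2) unfolding A_def by (auto simp: ceiling_le_iff) linarith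
  have "int N \<in> A" using q by (simp add: A_def ceiling_le_iff)
  have "finite A" by (simp add: A_def)
  have cardA: "q ^ 5 / 4 \<le> card A"
  proof -
    \<comment> \<open>The ceiling costs less than 1, and counting both endpoints gains 1.\<close>
    have "q ^ 5 / 4 \<le> real_of_int (int N - \<lceil>real N - q ^ 5 / 4\<rceil> + 1)" by linarith
    also have "\<dots> \<le> card A" unfolding A_def by simp
    finally show ?thesis .
  qed
  have sum_n: "(\<Sum>n\<in>?I. if n \<in> A then h n else 0) = sum h A" for h :: "int \<Rightarrow> 'b::comm_monoid_add"
    using \<open>A \<subseteq> ?I\<close> by (simp add: sum.If_cases Int_absorb1)
  have f_eq: "?f (x, y) = (\<Sum>n\<in>A. cis (2 * pi * ((n * x - n\<^sup>2 * x ^ 3) - (n * r - n\<^sup>2 * r ^ 3))))"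
    for x y :: real
  proof -
    have "?f (x, y) = (\<Sum>n\<in>?I. \<Sum>m\<in>?I. if m = 0 then
        if n \<in> A then cis (2 * pi * ((n * x - n\<^sup>2 * x ^ 3) - (n * r - n\<^sup>2 * r ^ 3))) else 0 else 0)"
      unfolding split a_def ee_of_real
      by (intro sum.cong refl) (auto simp: cis_mult algebra_simps)
    then show ?thesis by (simp add: sum_n)
  qed
  have norm_a: "(\<Sum>n\<in>?I. \<Sum>m\<in>?I. (cmod (a n m))\<^sup>2) = card A"
  proof -
    have "(\<Sum>n\<in>?I. \<Sum>m\<in>?I. (cmod (a n m))\<^sup>2) =
        (\<Sum>n\<in>?I. \<Sum>m\<in>?I. if m = 0 then if n \<in> A then 1 else 0 else 0)"
      unfolding a_def by (intro sum.cong refl) auto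
    then show ?thesis by (simp add: sum_n)
  qed
  have nonzero: "\<exists>n\<in>?I. \<exists>m\<in>?I. a n m \<noteq> 0"
    using \<open>int N \<in> A\<close> by (intro bexI[of _ "int N"] bexI[of _ 0]) (auto simp: a_def)
  \<comment> \<open>The sum does not depend on \<open>y\<close>, so the rectangle takes the full
    range -1 to 1 there.\<close>
  have lower: "real (card A) / 2 \<le> cmod (?f p)" if "p \<in> cbox (r, -1) (r + T, 1)" for p
  proof -
    obtain t y where p: "p = (r + t, y)"
    proof
      show "p = (r + (fst p - r), snd p)" by simp
    qed
    with that have t: "0 \<le> t" "t \<le> 1 / (4 * q ^ 4)"
      by (auto simp: cbox_Pair_eq T_def)
    let ?g = "real N * t - (real N)\<^sup>2 * ((r + t) ^ 3 - r ^ 3)"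
    show ?thesis unfolding p f_eq
    proof (rule cmod_sum_cis_ge[OF \<open>finite A\<close>, where g = "2 * pi * ?g"])
      fix n assume n: "n \<in> A"
      define k where "k = real N - n"
      have k: "0 \<le> k" "k \<le> q ^ 5 / 4"
        using n by (auto simp: A_def k_def ceiling_le_iff)
      have n_eq: "real_of_int n = real N - k" by (simp add: k_def)
      have "\<bar>(n * (r + t) - n\<^sup>2 * (r + t) ^ 3) - (n * r - n\<^sup>2 * r ^ 3) - ?g\<bar> \<le> 1 / 8"
        using phase_error_bound[OF q(1) r t k] phase_expansion[of "real N" r k t] r(2)
        unfolding q(2) of_int_power n_eq by simp
      then have "2 * pi * \<bar>(n * (r + t) - n\<^sup>2 * (r + t) ^ 3) - (n * r - n\<^sup>2 * r ^ 3) - ?g\<bar> \<le> 2 * pi * (1 / 8)"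
        by (intro mult_left_mono) auto
      \<comment> \<open>A phase error of 1/8 of a period is an angle of pi/4, within the tolerance
        pi/3.\<close>
      also have "\<dots> \<le> pi / 3" using pi_gt_zero by linarith
      finally show "\<bar>2 * pi * ((n * (r + t) - n\<^sup>2 * (r + t) ^ 3) - (n * r - n\<^sup>2 * r ^ 3)) - 2 * pi * ?g\<bar> \<le> pi / 3"
        by (simp add: abs_mult flip: right_diff_distrib)
    qed
  qed
  have "card A / 2 * sqrt (measure lborel (cbox (r, -1::real) (r + T, 1))) \<le> L2_norm_on ?S ?f"
  proof (rule L2_norm_on_ge)
    show "continuous_on ?S ?f"
      unfolding split_beta ee_def by (intro continuous_intros)
    show "cbox (r, - 1) (r + T, 1) \<subseteq> ?S"
      using r T \<open>r \<le> 1 / 2\<close> by (auto simp: cbox_Pair_eq)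
  qed (use lower in \<open>auto intro: compact_Times\<close>)
  also have "measure lborel (cbox (r, -1::real) (r + T, 1)) = 2 * T"
    using T by (simp add: content_Pair)
  finally have *: "card A / 2 * sqrt (2 * T) \<le> L2_norm_on ?S ?f" .
  have "1 / 8 * real N powr (1 / 12) = 1 / 8 * sqrt q"
    by (simp add: q_def powr_powr flip: powr_half_sqrt)
  also have "\<dots> = sqrt (q / 64)"
    by (simp add: real_sqrt_divide)
  \<comment> \<open>By the choice of \<open>T\<close> the right-hand radicand equals q / 32;
    weakening it to q / 64 gives the rational constant 1/8.\<close>
  also have "\<dots> \<le> sqrt (q ^ 5 / 4 * (2 * T) / 4)"
    using q by (intro real_sqrt_le_mono) (simp add: T_def field_simps flip: power_Suc)
  also have "\<dots> \<le> sqrt (card A * (2 * T) / 4)"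
    using cardA T by (intro real_sqrt_le_mono divide_right_mono mult_right_mono) auto
  also have "\<dots> = sqrt (card A) * sqrt (2 * T) / 2"
    by (simp only: real_sqrt_divide real_sqrt_mult real_sqrt_four)
  \<comment> \<open>The coefficients on \<open>A\<close> are unimodular, so
    \<open>sqrt (card A)\<close> is their l^2 norm; one such factor of the lower bound is spent on
    it.\<close>
  finally have "1 / 8 * real N powr (1 / 12) * sqrt (card A)
      \<le> sqrt (card A) * sqrt (2 * T) / 2 * sqrt (card A)"
    by (rule mult_right_mono) simp
  also have "\<dots> = card A / 2 * sqrt (2 * T)" by simp
  also note *
  finally have "1 / 8 * real N powr (1 / 12) * sqrt (\<Sum>n\<in>?I. \<Sum>m\<in>?I. (cmod (a n m))\<^sup>2)
      \<le> L2_norm_on ?S ?f"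
    unfolding norm_a .
  with nonzero show "\<exists>a :: int \<Rightarrow> int \<Rightarrow> complex. (\<exists>n\<in>?I. \<exists>m\<in>?I. a n m \<noteq> 0) \<and>
      1 / 8 * real N powr (1 / 12) * sqrt (\<Sum>n\<in>?I. \<Sum>m\<in>?I. (cmod (a n m))\<^sup>2)
      \<le> L2_norm_on ?S (\<lambda>(x, y). \<Sum>n\<in>?I. \<Sum>m\<in>?I.
          a n m * ee (of_real (of_int n * x + of_int m * y - of_int (n\<^sup>2 + m\<^sup>2) * x ^ 3)))"
    by blast
qed simp

end
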